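(* Let $\alpha \in (0,1]$ and $\beta >\alpha$. Suppose that there exist $c >0$, $C<\infty$, and $x_0 < \infty$ such that $\mathbb{E} [ (\Delta_t^+)^\alpha \mid \mathcal{F}_t ] \leq C$ a.s. for all $t \in \mathbb{Z}^+$, and, for all $x \geq x_0$ and all $t \in \mathbb{Z}^+$, $\mathbb{P} [ \Delta_t^- > x \mid \mathcal{F}_t ] \geq c x^{-\beta}$ a.s. Then for any $x \in \mathbb{R}$ and any $p > (\beta/\alpha) -1$, $\mathbb{E} [ \lambda_x^{p} ] = \infty$.
   Context: $\mathbb{Z}^+ = \{0,1,2,\ldots\}$. $(X_t)_{t \in \mathbb{Z}^+}$ is a real-valued stochastic process adapted to a filtration $(\mathcal{F}_t)_{t \in \mathbb{Z}^+}$, with $X_0 = 0$ (no Markov property is assumed). Its increments are $\Delta_t := X_{t+1} - X_t$. For real $x$, $x^+ := x \mathbf{1}\{x>0\}$ and $x^- := -x\mathbf{1}\{x<0\}$; $\Delta_t^\pm := (\Delta_t)^\pm$. For $x \in \mathbb{R}$, $\lambda_x := \max \{ t \in \mathbb{Z}^+ : X_t \leq x \}$ is the last exit time from $(-\infty,x]$, with $\lambda_x = \infty$ if $X_t \leq x$ for infinitely many $t$, and $\lambda_x = 0$ if $X_t > x$ for all $t$. The constants $c, C, x_0$ are non-random and do not depend on $t$; $x_0$ is understood to be positive so that powers of $x \geq x_0$ are defined. *)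

theory Defs
  imports "HOL-Probability.Probability"
begin

definition pos_part :: "real \<Rightarrow> real" where
  "pos_part x = (if x > 0 then x else 0)"

definition neg_part :: "real \<Rightarrow> real" where
  "neg_part x = (if x < 0 then - x else 0)"

definition increment :: "(nat \<Rightarrow> 'a \<Rightarrow> real) \<Rightarrow> nat \<Rightarrow> 'a \<Rightarrow> real" where
  "increment X t \<omega> = X (Suc t) \<omega> - X t \<omega>"

definition last_exit :: "(nat \<Rightarrow> 'a \<Rightarrow> real) \<Rightarrow> real \<Rightarrow> 'a \<Rightarrow> enat" where
  "last_exit X x \<omega> =
     (if infinite {t. X t \<omega> \<le> x} then \<infinity>
      else if {t. X t \<omega> \<le> x} = {} then 0
      else enat (Max {t. X t \<omega> \<le> x}))"

(* Powers of an extended natural number; the clause for \<infinity> is the usual convention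
   for a positive exponent, which is the only case intended. *)
definition enat_powr :: "enat \<Rightarrow> real \<Rightarrow> ennreal" where
  "enat_powr n p = (case n of enat k \<Rightarrow> ennreal (real k powr p) | \<infinity> \<Rightarrow> \<infinity>)"

end

theory Submission
  imports Defs "HOL-Real_Asymp.Real_Asymp"
begin

text \<open>
  The proof bounds the tail of the last exit time \<open>\<lambda>\<close> from below by
  \<open>\<P>(\<lambda> \<ge> n) \<ge> a n\<^sup>1\<^sup>-\<^sup>\<gamma>\<close> for \<open>n \<ge> 1\<close>, where
  \<open>\<gamma> = \<beta> / \<alpha>\<close> and \<open>a > 0\<close> does not depend on \<open>n\<close>. Then
  \<open>\<E>[\<lambda>\<^sup>p] \<ge> n\<^sup>p \<P>(\<lambda> \<ge> n)\<close> is at least of order \<open>n\<close> to the positive power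
  \<open>p - (\<gamma> - 1)\<close> for every such \<open>n\<close>, so the moment is infinite.

  The tail bound weighs two scales against each other. Since \<open>\<alpha> \<le> 1\<close>, the map
  \<open>u \<mapsto> (u\<^sup>+)\<^sup>\<alpha>\<close> is subadditive, so \<open>\<E>[(X\<^sub>t\<^sup>+)\<^sup>\<alpha>] \<le> C t\<close>
  (lemma \<open>nn_integral_pos_part_powr_le\<close>), and by Markov's inequality each \<open>X\<^sub>s\<close> with
  \<open>s < 2 n\<close> lies below a level \<open>Y\<close> of order \<open>n\<close> to the power \<open>1 / \<alpha>\<close>
  with probability at least one half (lemma \<open>prob_le_ge_half\<close>).
  From below \<open>Y\<close>, one downward jump of size of order \<open>Y\<close> suffices to get below \<open>x\<close>, and
  whatever the past, such a jump has probability at least of order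
  \<open>Y\<^sup>-\<^sup>\<beta>\<close>, that is, \<open>n\<^sup>-\<^sup>\<gamma>\<close>. There are \<open>n\<close> opportunities in the window
  \<open>[n, 2 n)\<close>, and a first-success decomposition makes their probabilities add up to
  \<open>n\<^sup>1\<^sup>-\<^sup>\<gamma>\<close> (lemma \<open>prob_return_in_window_ge\<close>).
\<close>

section \<open>Subadditivity of powers of positive parts\<close>

text \<open>
  Normalising to \<open>a + b = 1\<close> reduces the claim to \<open>u \<le> u\<^sup>\<alpha>\<close> on the unit interval.
\<close>
lemma powr_add_le_add_powr:
  fixes a b \<alpha> :: real
  assumes "a \<ge> 0" "b \<ge> 0" "0 < \<alpha>" "\<alpha> \<le> 1"
  shows "(a + b) powr \<alpha> \<le> a powr \<alpha> + b powr \<alpha>"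
proof (cases "a + b = 0")
  case True
  then show ?thesis using assms by simp
next
  case False
  define s where "s = a + b"
  have s: "s > 0" using False assms by (simp add: s_def)
  have le: "u \<le> u powr \<alpha>" if "0 \<le> u" "u \<le> 1" for u :: real
    using powr_mono'[of \<alpha> 1 u] that assms by simp
  have "1 = a / s + b / s" using s by (simp add: s_def flip: add_divide_distrib)
  also have "\<dots> \<le> (a / s) powr \<alpha> + (b / s) powr \<alpha>"
    using assms s by (intro add_mono le) (auto simp: s_def)
  also have "\<dots> = (a powr \<alpha> + b powr \<alpha>) / s powr \<alpha>"
    using assms s by (simp add: powr_divide add_divide_distrib)
  finally show ?thesis using s by (simp add: field_simps s_def)
qed

lemma pos_part_powr_add_le:
  assumes "0 < \<alpha>" "\<alpha> \<le> 1"
  shows "pos_part (a + b) powr \<alpha> \<le> pos_part a powr \<alpha> + pos_part b powr \<alpha>"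
proof -
  have "pos_part (a + b) powr \<alpha> \<le> (pos_part a + pos_part b) powr \<alpha>"
    using assms by (intro powr_mono2) (auto simp: pos_part_def)
  also have "\<dots> \<le> pos_part a powr \<alpha> + pos_part b powr \<alpha>"
    using assms by (intro powr_add_le_add_powr) (auto simp: pos_part_def)
  finally show ?thesis .
qed

lemma borel_measurable_pos_part [measurable]: "pos_part \<in> borel_measurable borel"
  unfolding pos_part_def by measurable

lemma borel_measurable_neg_part [measurable]: "neg_part \<in> borel_measurable borel"
  unfolding neg_part_def by measurable

section \<open>From conditional to unconditional bounds\<close>

context prob_space
begin

lemma nn_integral_le_of_cond_exp_le:
  assumes "subalgebra M G" and f: "f \<in> borel_measurable M"
    and "AE \<omega> in M. nn_cond_exp M G f \<omega> \<le> C"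
  shows "(\<integral>\<^sup>+ \<omega>. f \<omega> \<partial>M) \<le> C"
proof -
  interpret finite_measure_subalgebra M G
    by unfold_locales (fact assms(1))
  have "(\<integral>\<^sup>+ \<omega>. f \<omega> \<partial>M) = (\<integral>\<^sup>+ \<omega>. 1 * nn_cond_exp M G f \<omega> \<partial>M)"
    using nn_cond_exp_intg[of "\<lambda>_. 1" f] f by simp
  also have "\<dots> \<le> (\<integral>\<^sup>+ \<omega>. C \<partial>M)"
    using assms(3) by (intro nn_integral_mono_AE) auto
  finally show ?thesis by (simp add: emeasure_space_1)
qed

text \<open>
  The defining property of conditional expectation allows integrating the lower bound over
  \<open>A\<close>. Here \<open>A\<close> will be an event of the past and \<open>B\<close> the next jump being large.
\<close>
lemma prob_Int_ge_of_cond_prob_ge: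
  assumes sub: "subalgebra M G" and A: "A \<in> sets G" and B: "B \<in> sets M"
    and "AE \<omega> in M. real_cond_exp M G (indicat_real B) \<omega> \<ge> \<delta>"
  shows "\<delta> * prob A \<le> prob (A \<inter> B)"
proof -
  interpret finite_measure_subalgebra M G
    by unfold_locales (fact sub)
  have AM: "A \<in> sets M" using A sub by (auto simp: subalgebra_def)
  have int: "integrable M (indicat_real B)"
    using B by (simp add: integrable_indicator_iff less_top[symmetric])
  have "\<delta> * prob A = (\<integral>\<omega>. indicat_real A \<omega> * \<delta> \<partial>M)"
    using AM by simp
  also have "\<dots> \<le> (\<integral>\<omega>. indicat_real A \<omega> * real_cond_exp M G (indicat_real B) \<omega> \<partial>M)"
  proof (rule integral_mono_AE)
    show "integrable M (\<lambda>\<omega>. indicat_real A \<omega> * \<delta>)"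
      using AM by (simp add: integrable_indicator_iff less_top[symmetric])
    show "integrable M (\<lambda>\<omega>. indicat_real A \<omega> * real_cond_exp M G (indicat_real B) \<omega>)"
      using integrable_mult_indicator[OF AM real_cond_exp_int(1)[OF int]] by simp
    show "AE \<omega> in M. indicat_real A \<omega> * \<delta>
            \<le> indicat_real A \<omega> * real_cond_exp M G (indicat_real B) \<omega>"
      using assms(4) by eventually_elim (auto simp: indicator_def)
  qed
  also have "\<dots> = (\<integral>\<omega>. indicat_real A \<omega> * indicat_real B \<omega> \<partial>M)"
    using real_cond_exp_intA[OF int A] by (simp add: set_lebesgue_integral_def)
  also have "\<dots> = prob (A \<inter> B)"
    using AM B by (simp add: indicator_inter_arith[symmetric])
  finally show ?thesis .
qed

section \<open>Growth of the process\<close>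

text \<open>
  Pointwise subadditivity makes the \<open>\<alpha>\<close>-th moments of the upward increments add up, whatever
  the dependence between the increments.
\<close>
lemma nn_integral_pos_part_powr_le:
  fixes X :: "nat \<Rightarrow> 'a \<Rightarrow> real"
  assumes [measurable]: "\<And>t. X t \<in> borel_measurable M"
    and X0: "\<And>\<omega>. \<omega> \<in> space M \<Longrightarrow> X 0 \<omega> = 0"
    and \<alpha>: "0 < \<alpha>" "\<alpha> \<le> 1"
    and incr: "\<And>t. (\<integral>\<^sup>+ \<omega>. ennreal (pos_part (increment X t \<omega>) powr \<alpha>) \<partial>M) \<le> C"
  shows "(\<integral>\<^sup>+ \<omega>. ennreal (pos_part (X t \<omega>) powr \<alpha>) \<partial>M) \<le> of_nat t * C"
proof (induction t)
  case 0
  have "(\<integral>\<^sup>+ \<omega>. ennreal (pos_part (X 0 \<omega>) powr \<alpha>) \<partial>M) = (\<integral>\<^sup>+ \<omega>. 0 \<partial>M)"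
    using X0 by (intro nn_integral_cong) (simp add: pos_part_def)
  then show ?case by simp
next
  case (Suc t)
  have [measurable]: "increment X t \<in> borel_measurable M"
    unfolding increment_def by measurable
  have "(\<integral>\<^sup>+ \<omega>. ennreal (pos_part (X (Suc t) \<omega>) powr \<alpha>) \<partial>M)
      \<le> (\<integral>\<^sup>+ \<omega>. ennreal (pos_part (X t \<omega>) powr \<alpha>)
              + ennreal (pos_part (increment X t \<omega>) powr \<alpha>) \<partial>M)"
  proof (rule nn_integral_mono)
    fix \<omega>
    have "X (Suc t) \<omega> = X t \<omega> + increment X t \<omega>" by (simp add: increment_def)
    then show "ennreal (pos_part (X (Suc t) \<omega>) powr \<alpha>)
        \<le> ennreal (pos_part (X t \<omega>) powr \<alpha>) + ennreal (pos_part (increment X t \<omega>) powr \<alpha>)"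
      using pos_part_powr_add_le[OF \<alpha>] by (simp flip: ennreal_plus)
  qed
  also have "\<dots> = (\<integral>\<^sup>+ \<omega>. ennreal (pos_part (X t \<omega>) powr \<alpha>) \<partial>M)
      + (\<integral>\<^sup>+ \<omega>. ennreal (pos_part (increment X t \<omega>) powr \<alpha>) \<partial>M)"
    by (rule nn_integral_add) measurable
  also have "\<dots> \<le> of_nat t * C + C" by (intro add_mono Suc.IH incr)
  finally show ?case by (simp add: distrib_right add.commute)
qed

lemma prob_le_ge_half:
  fixes Z :: "'a \<Rightarrow> real"
  assumes [measurable]: "Z \<in> borel_measurable M"
    and "0 < \<alpha>" "0 < Y" "0 \<le> m" "2 * m \<le> Y powr \<alpha>"
    and mom: "(\<integral>\<^sup>+ \<omega>. ennreal (pos_part (Z \<omega>) powr \<alpha>) \<partial>M) \<le> ennreal m"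
  shows "prob {\<omega> \<in> space M. Z \<omega> \<le> Y} \<ge> 1 / 2"
proof -
  have "ennreal (Y powr \<alpha>) * emeasure M {\<omega> \<in> space M. Z \<omega> > Y}
      = (\<integral>\<^sup>+ \<omega>. ennreal (Y powr \<alpha>) * indicator {\<omega> \<in> space M. Z \<omega> > Y} \<omega> \<partial>M)"
    by (simp add: nn_integral_cmult_indicator)
  also have "\<dots> \<le> (\<integral>\<^sup>+ \<omega>. ennreal (pos_part (Z \<omega>) powr \<alpha>) \<partial>M)"
    using assms(2,3)
    by (intro nn_integral_mono)
       (auto simp: indicator_def pos_part_def intro!: ennreal_leI powr_mono2)
  also have "\<dots> \<le> ennreal m" by (rule mom)
  finally have "Y powr \<alpha> * prob {\<omega> \<in> space M. Z \<omega> > Y} \<le> m"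
    using assms(4) by (simp add: emeasure_eq_measure flip: ennreal_mult)
  also have "m \<le> Y powr \<alpha> * (1 / 2)" using assms(5) by simp
  finally have "prob {\<omega> \<in> space M. Z \<omega> > Y} \<le> 1 / 2"
    using assms(3) by (subst (asm) mult_le_cancel_left_pos) auto
  moreover have "prob {\<omega> \<in> space M. Z \<omega> \<le> Y} = 1 - prob {\<omega> \<in> space M. Z \<omega> > Y}"
    by (subst prob_compl[symmetric]) (auto intro!: arg_cong[where f = prob])
  ultimately show ?thesis by simp
qed

section \<open>Returns below a fixed level\<close>

text \<open>
  Let \<open>q\<close> be the probability to be bounded. At each time \<open>s\<close> of the window, the process is
  below \<open>Y\<close> without having returned earlier in the window with probability at least
  \<open>1 / 2 - q\<close>, and then it returns at the next step with conditional probability at least \<open>\<delta>\<close>.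
  These first returns are disjoint for different \<open>s\<close>, hence \<open>q \<ge> k \<delta> (1 / 2 - q)\<close>: either
  \<open>q \<ge> 1 / 4\<close>, or \<open>q \<ge> k \<delta> / 4\<close>.
\<close>
lemma prob_return_in_window_ge:
  fixes X :: "nat \<Rightarrow> 'a \<Rightarrow> real"
  assumes filt: "filtration (space M) F" and sub: "\<And>t. subalgebra M (F t)"
    and adapted: "\<And>t. X t \<in> borel_measurable (F t)"
    and tight: "\<And>s. s \<in> {n..<n + k} \<Longrightarrow> prob {\<omega> \<in> space M. X s \<omega> \<le> Y} \<ge> 1 / 2"
    and \<delta>: "0 \<le> \<delta>" "Y - y \<le> x"
    and drop: "\<And>s. AE \<omega> in M. real_cond_exp M (F s)
             (indicat_real {\<omega> \<in> space M. neg_part (increment X s \<omega>) > y}) \<omega> \<ge> \<delta>"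
    and y: "0 \<le> y"
  shows "prob {\<omega> \<in> space M. \<exists>s\<in>{n..<n + k}. X (Suc s) \<omega> \<le> x} \<ge> min (1 / 4) (\<delta> * k / 4)"
proof -
  interpret filtration "space M" F by (rule filt)
  \<comment> \<open>\<open>R\<close>: some return in the window; \<open>G s\<close>: low at time \<open>s\<close> with no return so far;
    \<open>D s\<close>: a drop at time \<open>s\<close> that is large enough to turn \<open>G s\<close> into a return.\<close>
  define R where "R = {\<omega> \<in> space M. \<exists>s\<in>{n..<n + k}. X (Suc s) \<omega> \<le> x}"
  define G where "G s = {\<omega> \<in> space M. X s \<omega> \<le> Y \<and> (\<forall>r\<in>{n..<s}. x < X (Suc r) \<omega>)}" for s
  define D where "D s = {\<omega> \<in> space M. neg_part (increment X s \<omega>) > y}" for s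
  have G: "G s \<in> sets (F s)" for s
  proof -
    have XF: "X r \<in> borel_measurable (F s)" if "r \<le> s" for r
      using adapted[of r] sets_F_mono[OF that] by (auto simp: measurable_def space_F)
    have "{\<omega> \<in> space (F s). X s \<omega> \<le> Y \<and> (\<forall>r\<in>{n..<s}. x < X (Suc r) \<omega>)} \<in> sets (F s)"
    proof (intro sets.sets_Collect_conj sets.sets_Collect_finite_All)
      show "{\<omega> \<in> space (F s). X s \<omega> \<le> Y} \<in> sets (F s)"
        by (intro borel_measurable_le adapted borel_measurable_const)
      show "{\<omega> \<in> space (F s). x < X (Suc r) \<omega>} \<in> sets (F s)" if "r \<in> {n..<s}" for r
        using that by (intro borel_measurable_less XF borel_measurable_const) simp
    qed simp
    then show ?thesis by (simp add: G_def space_F)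
  qed
  have [measurable]: "X t \<in> borel_measurable M" for t
    using measurable_from_subalg[OF sub adapted] .
  have [measurable]: "R \<in> sets M" unfolding R_def by measurable
  have D [measurable]: "D s \<in> sets M" for s unfolding D_def increment_def by measurable
  have GM [measurable]: "G s \<in> sets M" for s using G sub by (auto simp: subalgebra_def)
  have GD_R: "G s \<inter> D s \<subseteq> R" if "s \<in> {n..<n + k}" for s
  proof
    fix \<omega> assume \<omega>: "\<omega> \<in> G s \<inter> D s"
    then have "X (Suc s) \<omega> \<le> x"
      using \<delta>(2) y by (auto simp: G_def D_def neg_part_def increment_def split: if_splits)
    with \<omega> that show "\<omega> \<in> R" by (auto simp: R_def G_def)
  qed
  have disj: "disjoint_family_on (\<lambda>s. G s \<inter> D s) {n..<n + k}"
  proof -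
    have "\<not> (\<omega> \<in> G s \<inter> D s \<and> \<omega> \<in> G r \<inter> D r)" if "s < r" "s \<ge> n" for s r \<omega>
    proof
      assume *: "\<omega> \<in> G s \<inter> D s \<and> \<omega> \<in> G r \<inter> D r"
      then have "X (Suc s) \<omega> \<le> x"
        using \<delta>(2) y by (auto simp: G_def D_def neg_part_def increment_def split: if_splits)
      moreover have "x < X (Suc s) \<omega>" using * that by (auto simp: G_def)
      ultimately show False by simp
    qed
    then show ?thesis
      unfolding disjoint_family_on_def
      by (metis (no_types, lifting) atLeastLessThan_iff disjoint_iff linorder_neqE_nat)
  qed
  have probG: "prob (G s) \<ge> 1 / 2 - prob R" if "s \<in> {n..<n + k}" for s
  proof -
    have "{\<omega> \<in> space M. X s \<omega> \<le> Y} \<subseteq> G s \<union> R"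
    proof
      fix \<omega> assume \<omega>: "\<omega> \<in> {\<omega> \<in> space M. X s \<omega> \<le> Y}"
      show "\<omega> \<in> G s \<union> R"
      proof (cases "\<exists>r\<in>{n..<s}. X (Suc r) \<omega> \<le> x")
        case True
        then obtain r where r: "r \<in> {n..<s}" "X (Suc r) \<omega> \<le> x" by blast
        then have "r \<in> {n..<n + k}" using that by simp
        then have "\<omega> \<in> R" using \<omega> r(2) unfolding R_def by blast
        then show ?thesis by blast
      next
        case False
        then show ?thesis using \<omega> by (simp add: G_def not_le)
      qed
    qed
    then have "prob {\<omega> \<in> space M. X s \<omega> \<le> Y} \<le> prob (G s \<union> R)"
      by (intro finite_measure_mono) auto
    also have "\<dots> \<le> prob (G s) + prob R" by (intro measure_Un_le) auto
    finally show ?thesis using tight[OF that] by simp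
  qed
  have "real k * (\<delta> * (1 / 2 - prob R)) = (\<Sum>s\<in>{n..<n + k}. \<delta> * (1 / 2 - prob R))" by simp
  also have "\<dots> \<le> (\<Sum>s\<in>{n..<n + k}. prob (G s \<inter> D s))"
  proof (rule sum_mono)
    fix s assume s: "s \<in> {n..<n + k}"
    have "\<delta> * (1 / 2 - prob R) \<le> \<delta> * prob (G s)"
      by (intro mult_left_mono probG s \<delta>)
    also have "\<dots> \<le> prob (G s \<inter> D s)"
      using drop by (intro prob_Int_ge_of_cond_prob_ge[OF sub G D]) (simp add: D_def)
    finally show "\<delta> * (1 / 2 - prob R) \<le> prob (G s \<inter> D s)" .
  qed
  also have "\<dots> = prob (\<Union>s\<in>{n..<n + k}. G s \<inter> D s)"
    using disj by (intro finite_measure_finite_Union[symmetric]) auto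
  also have "\<dots> \<le> prob R" by (intro finite_measure_mono UN_least GD_R) auto
  finally have *: "real k * (\<delta> * (1 / 2 - prob R)) \<le> prob R" .
  have "min (1 / 4) (\<delta> * k / 4) \<le> prob R"
  proof (cases "prob R \<ge> 1 / 4")
    case False
    then have "\<delta> * k * (1 / 4) \<le> \<delta> * k * (1 / 2 - prob R)"
      using \<delta> by (intro mult_left_mono) auto
    also have "\<dots> \<le> prob R" using * by (simp only: mult_ac)
    finally show ?thesis by (simp add: min_le_iff_disj)
  qed auto
  then show ?thesis by (simp add: R_def)
qed

end

section \<open>Moments of the last exit time\<close>

lemma enat_powr_last_exit_ge:
  assumes "X t \<omega> \<le> x" "n \<le> t" "0 < p"
  shows "ennreal (real n powr p) \<le> enat_powr (last_exit X x \<omega>) p"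
proof (cases "infinite {t. X t \<omega> \<le> x}")
  case True
  then show ?thesis by (simp add: last_exit_def enat_powr_def)
next
  case False
  then have "t \<le> Max {t. X t \<omega> \<le> x}" using assms(1) by (intro Max_ge) auto
  then have "real n powr p \<le> real (Max {t. X t \<omega> \<le> x}) powr p"
    using assms by (intro powr_mono2) auto
  with False assms(1) show ?thesis
    by (auto simp: last_exit_def enat_powr_def intro!: ennreal_leI)
qed

text \<open>
  Markov's inequality for the last exit time, with the event that it is at least \<open>n\<close>
  replaced by any measurable event that forces this.
\<close>
lemma nn_integral_enat_powr_last_exit_ge:
  assumes "0 < p" and A: "A \<in> sets M"
    and "\<And>\<omega>. \<omega> \<in> A \<Longrightarrow> \<exists>t\<ge>n. X t \<omega> \<le> x"
  shows "ennreal (real n powr p) * emeasure M A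
           \<le> (\<integral>\<^sup>+ \<omega>. enat_powr (last_exit X x \<omega>) p \<partial>M)"
proof -
  have "ennreal (real n powr p) * emeasure M A
      = (\<integral>\<^sup>+ \<omega>. ennreal (real n powr p) * indicator A \<omega> \<partial>M)"
    using A by (simp add: nn_integral_cmult_indicator)
  also have "\<dots> \<le> (\<integral>\<^sup>+ \<omega>. enat_powr (last_exit X x \<omega>) p \<partial>M)"
  proof (rule nn_integral_mono)
    fix \<omega>
    show "ennreal (real n powr p) * indicator A \<omega> \<le> enat_powr (last_exit X x \<omega>) p"
      using assms(3)[of \<omega>] enat_powr_last_exit_ge[of X _ \<omega> x n p] assms(1)
      by (auto simp: indicator_def)
  qed
  finally show ?thesis .
qed

theorem theorem2p7:
  fixes M :: "'a measure"
    and F :: "nat \<Rightarrow> 'a measure"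
    and X :: "nat \<Rightarrow> 'a \<Rightarrow> real"
    and \<alpha> \<beta> c x\<^sub>0 x p :: real
    and C :: ennreal
  assumes "prob_space M"
    and "filtration (space M) F"
    and "\<And>t. subalgebra M (F t)"
    and "\<And>t. X t \<in> borel_measurable (F t)"
    and "\<And>\<omega>. \<omega> \<in> space M \<Longrightarrow> X 0 \<omega> = 0"
    and "0 < \<alpha>" and "\<alpha> \<le> 1" and "\<alpha> < \<beta>"
    and "c > 0" and "C < \<infinity>" and "x\<^sub>0 > 0"
    and "\<And>t. AE \<omega> in M.
           nn_cond_exp M (F t) (\<lambda>\<omega>. ennreal (pos_part (increment X t \<omega>) powr \<alpha>)) \<omega> \<le> C"
    and "\<And>y t. y \<ge> x\<^sub>0 \<Longrightarrow> AE \<omega> in M.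
           real_cond_exp M (F t)
             (indicat_real {\<omega> \<in> space M. neg_part (increment X t \<omega>) > y}) \<omega>
           \<ge> c * y powr (- \<beta>)"
    and "p > \<beta> / \<alpha> - 1"
  shows "(\<integral>\<^sup>+ \<omega>. enat_powr (last_exit X x \<omega>) p \<partial>M) = \<infinity>"
proof -
  interpret prob_space M by fact
  have XM [measurable]: "X t \<in> borel_measurable M" for t
    using measurable_from_subalg[OF assms(3,4)] .
  have ratio: "\<beta> / \<alpha> > 1" using assms(6,8) by (simp add: field_simps)
  then have p: "p > 0" using assms(14) by simp
  define C' where "C' = enn2real C"
  have C': "C' \<ge> 0" "C = ennreal C'" using assms(10) by (auto simp: C'_def)
  \<comment> \<open>The factor \<open>4\<close> makes Markov's inequality give one half at all times up to \<open>2 n\<close>; adding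
    \<open>1\<close> to \<open>C'\<close> keeps the level positive when \<open>C' = 0\<close>.\<close>
  define Y where "Y n = (4 * (C' + 1) * real n) powr (1 / \<alpha>)" for n :: nat
  \<comment> \<open>A drop by more than \<open>Y n + \<bar>x\<bar> + x\<^sub>0\<close> leads from below \<open>Y n\<close> to below \<open>x\<close>, and it lies in
    the range where the lower tail bound applies. The constant \<open>K\<close> absorbs the terms that do
    not grow with \<open>n\<close>.\<close>
  define K where "K = (4 * (C' + 1)) powr (1 / \<alpha>) + \<bar>x\<bar> + x\<^sub>0"
  have K: "K > 0" using assms(11) by (simp add: K_def add_nonneg_pos)
  define \<delta> where "\<delta> n = c * (K powr - \<beta> * real n powr (- (\<beta> / \<alpha>)))" for n :: nat
  define R where "R n = {\<omega> \<in> space M. \<exists>s\<in>{n..<n + n}. X (Suc s) \<omega> \<le> x}" for n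
  have R [measurable]: "R n \<in> sets M" for n unfolding R_def by measurable
  have probR: "prob (R n) \<ge> min (1 / 4) (\<delta> n * n / 4)" if n: "n \<ge> 1" for n
    unfolding R_def
  proof (rule prob_return_in_window_ge[OF assms(2,3,4)])
    have Ypow: "Y n powr \<alpha> = 4 * (C' + 1) * real n"
      using C'(1) n assms(6) by (simp add: Y_def powr_powr)
    have Ypos: "Y n > 0" using C'(1) n by (simp add: Y_def)
    let ?y = "Y n + \<bar>x\<bar> + x\<^sub>0"
    show "1 / 2 \<le> prob {\<omega> \<in> space M. X s \<omega> \<le> Y n}" if s: "s \<in> {n..<n + n}" for s
    proof (rule prob_le_ge_half)
      have inc: "(\<integral>\<^sup>+ \<omega>. ennreal (pos_part (increment X t \<omega>) powr \<alpha>) \<partial>M) \<le> C" for t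
      proof (rule nn_integral_le_of_cond_exp_le[OF assms(3) _ assms(12)])
        show "(\<lambda>\<omega>. ennreal (pos_part (increment X t \<omega>) powr \<alpha>)) \<in> borel_measurable M"
          unfolding increment_def by measurable
      qed
      show "(\<integral>\<^sup>+ \<omega>. ennreal (pos_part (X s \<omega>) powr \<alpha>) \<partial>M) \<le> ennreal (real s * C')"
        using nn_integral_pos_part_powr_le[OF XM assms(5,6,7) inc, of s] C'
        by (simp add: ennreal_mult ennreal_of_nat_eq_real_of_nat)
      have "2 * (real s * C') \<le> 2 * ((2 * real n) * (C' + 1))"
        using s C'(1) by (intro mult_left_mono mult_mono) auto
      then show "2 * (real s * C') \<le> Y n powr \<alpha>" by (simp add: Ypow mult_ac)
    qed (use XM assms(6) Ypos C'(1) in auto)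
    show "0 \<le> \<delta> n" using assms(9) by (simp add: \<delta>_def)
    show "Y n - ?y \<le> x" using assms(11) by simp
    show "0 \<le> ?y" using assms(11) Ypos by simp
    fix s
    have "?y \<le> K * real n powr (1 / \<alpha>)"
    proof -
      have "1 \<le> real n powr (1 / \<alpha>)" using n assms(6) by (intro ge_one_powr_ge_zero) auto
      then have "(\<bar>x\<bar> + x\<^sub>0) * 1 \<le> (\<bar>x\<bar> + x\<^sub>0) * real n powr (1 / \<alpha>)"
        using assms(11) by (intro mult_left_mono) auto
      moreover have "Y n = (4 * (C' + 1)) powr (1 / \<alpha>) * real n powr (1 / \<alpha>)"
        unfolding Y_def by (rule powr_mult)
      ultimately show ?thesis by (simp add: K_def algebra_simps)
    qed
    then have "(K * real n powr (1 / \<alpha>)) powr (- \<beta>) \<le> ?y powr (- \<beta>)"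
      using assms(6,8,11) Ypos by (intro powr_mono2') auto
    moreover have "(K * real n powr (1 / \<alpha>)) powr (- \<beta>)
        = K powr - \<beta> * real n powr (- (\<beta> / \<alpha>))"
      using K by (simp add: powr_mult powr_powr)
    ultimately have "\<delta> n \<le> c * ?y powr (- \<beta>)"
      unfolding \<delta>_def using assms(9) by (intro mult_left_mono) auto
    moreover have "AE \<omega> in M. c * ?y powr (- \<beta>) \<le> real_cond_exp M (F s)
        (indicat_real {\<omega> \<in> space M. ?y < neg_part (increment X s \<omega>)}) \<omega>"
      using Ypos by (intro assms(13)) simp
    ultimately show "AE \<omega> in M. \<delta> n \<le> real_cond_exp M (F s)
        (indicat_real {\<omega> \<in> space M. ?y < neg_part (increment X s \<omega>)}) \<omega>"
      by (auto elim: eventually_mono)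
  qed
  let ?b = "\<lambda>n::nat. real n powr p * min (1 / 4) (\<delta> n * n / 4)"
  let ?I = "\<integral>\<^sup>+ \<omega>. enat_powr (last_exit X x \<omega>) p \<partial>M"
  have lower: "ennreal (?b n) \<le> ?I" if "n \<ge> 1" for n
  proof -
    have "ennreal (?b n) \<le> ennreal (real n powr p * prob (R n))"
      using probR[OF that] by (intro ennreal_leI mult_left_mono) auto
    also have "\<dots> = ennreal (real n powr p) * emeasure M (R n)"
      by (simp add: emeasure_eq_measure ennreal_mult)
    also have "\<dots> \<le> ?I"
    proof (rule nn_integral_enat_powr_last_exit_ge[OF p R])
      fix \<omega> assume "\<omega> \<in> R n"
      then obtain s where "s \<ge> n" "X (Suc s) \<omega> \<le> x" by (auto simp: R_def)
      then show "\<exists>t\<ge>n. X t \<omega> \<le> x" by (intro exI[of _ "Suc s"]) auto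
    qed
    finally show ?thesis .
  qed
  \<comment> \<open>As \<open>\<beta> / \<alpha> > 1\<close>, the power of \<open>n\<close> in \<open>\<delta> n * n\<close> is at most \<open>1\<close>, so the minimum with
    \<open>1 / 4\<close> costs only a constant factor.\<close>
  define a where "a = min (1 / 4) (c * K powr - \<beta> / 4)"
  have a: "a > 0" using assms(9) K by (simp add: a_def)
  define q where "q = p - (\<beta> / \<alpha> - 1)"
  have q: "q > 0" using assms(14) by (simp add: q_def)
  have grow: "a * real n powr q \<le> ?b n" if n: "n \<ge> 1" for n
  proof -
    let ?g = "real n powr (1 - \<beta> / \<alpha>)"
    have g: "?g = real n * real n powr (- (\<beta> / \<alpha>))"
      using n by (simp add: powr_diff powr_minus field_simps)
    have "?g \<le> 1" using n ratio powr_mono[of "1 - \<beta> / \<alpha>" 0 "real n"] by simp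
    then have "a * ?g \<le> (1 / 4) * 1" by (intro mult_mono) (auto simp: a_def)
    moreover have "a * ?g \<le> (c * K powr - \<beta> / 4) * ?g"
      by (intro mult_right_mono) (auto simp: a_def)
    moreover have "(c * K powr - \<beta> / 4) * ?g = \<delta> n * n / 4"
      by (simp add: \<delta>_def g)
    ultimately have "a * ?g \<le> min (1 / 4) (\<delta> n * n / 4)" by simp
    then have "real n powr p * (a * ?g) \<le> ?b n" by (intro mult_left_mono) auto
    moreover have "real n powr q = real n powr p * ?g"
      unfolding powr_add[symmetric] by (simp add: q_def algebra_simps)
    ultimately show ?thesis by (simp add: mult_ac)
  qed
  have "filterlim (\<lambda>n. a * real n powr q) at_top sequentially"
    using a q by real_asymp
  then have unbounded: "\<exists>n\<ge>1. a * real n powr q > B" for B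
    using eventually_happens[OF eventually_conj[OF eventually_ge_at_top[of 1]]]
    unfolding filterlim_at_top_dense by (metis sequentially_bot)
  show ?thesis
  proof (rule ccontr)
    assume "?I \<noteq> \<infinity>"
    then obtain B where B: "?I = ennreal B" "B \<ge> 0" by (cases ?I) auto
    obtain n where n: "n \<ge> 1" "a * real n powr q > B" using unbounded by blast
    have "ennreal (?b n) \<le> ennreal B" using lower[OF n(1)] B by simp
    then have "?b n \<le> B" using B(2) by (simp add: ennreal_le_iff)
    with grow[OF n(1)] n(2) show False by simp
  qed
qed

end
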